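(* Let $\mathcal A\subset V^*$ be a $\vee$-system, let $\kappa\in\mathbb C$, and let $\psi:V\to V$ be a polynomial vector field satisfying $$\partial_\xi\psi(x)=\kappa\sum_{\alpha\in\mathcal A}\frac{\alpha(\xi)\,\alpha(\psi(x))}{\alpha(x)}\,\alpha^\vee\qquad\text{for all }\xi\in V,\ x\in\Sigma=V\setminus\bigcup_{\alpha\in\mathcal A}\{\alpha=0\}.$$ Then $\psi$ is a gradient logarithmic vector field for the arrangement $\Delta_{\mathcal A}=\bigcup_{\alpha\in\mathcal A}\{\alpha=0\}$, and its degree is $\deg\psi=\kappa$.
   Context: $V$ is a finite-dimensional complex vector space. A finite set $\mathcal A\subset V^*$ of pairwise non-collinear covectors spanning $V^*$, with canonical form $G_{\mathcal A}(x,y)=\sum_{\alpha\in\mathcal A}\alpha(x)\alpha(y)$ non-degenerate, is a $\vee$-system if, with $\alpha^\vee\in V$ defined by $G_{\mathcal A}(\alpha^\vee,x)=\alpha(x)$ for all $x$, for every $\alpha\in\mathcal A$ and every two-dimensional plane $\Pi\subset V^*$ containing $\alpha$ one has $\sum_{\beta\in\Pi\cap\mathcal A}\beta(\alpha^\vee)\beta^\vee=\nu\alpha^\vee$ for some $\nu$, which may depend on $\Pi$ and $\alpha$. A vector field $\psi$ is gradient if there is a polynomial $F$ on $V$ (the potential) with $G_{\mathcal A}(\psi(x),\eta)=\partial_\eta F(x)$ for all $x,\eta\in V$. A polynomial vector field is logarithmic for $\Delta_{\mathcal A}$ if it is tangent to every hyperplane of $\Delta_{\mathcal A}$, i.e.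 $\alpha(\psi(x))=0$ whenever $\alpha(x)=0$, for each $\alpha\in\mathcal A$. The degree of a homogeneous polynomial vector field is the degree of any of its nonzero components.
   Formalization: The logarithmic conclusion is stated only for κ ≠ 0 (for κ = 0 nonzero constant fields satisfy the equation but are not logarithmic), and deg ψ = κ is stated only for ψ not identically zero, since the zero field has no degree. *)

theory Defs
  imports Complex_Main "HOL-Library.Function_Algebras"
begin

text \<open>
  The ambient space \<open>V\<close> is the type \<open>'v\<close> with an explicit scalar multiplication
  \<open>scale\<close>, as in \<^locale>\<open>finite_dimensional_vector_space\<close>. Covectors are functions
  \<open>'v \<Rightarrow> complex\<close>; the dual space is a subspace of the space of all such functions.
\<close>

definition dual_space :: "(complex \<Rightarrow> 'v::ab_group_add \<Rightarrow> 'v) \<Rightarrow> ('v \<Rightarrow> complex) set" where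
  "dual_space scale = {f. Vector_Spaces.linear scale (*) f}"

definition fun_scale :: "complex \<Rightarrow> ('v \<Rightarrow> complex) \<Rightarrow> ('v \<Rightarrow> complex)" where
  "fun_scale c f = (\<lambda>x. c * f x)"

lemma vector_space_fun_scale: "vector_space fun_scale"
  by unfold_locales (auto simp: fun_scale_def fun_eq_iff algebra_simps)

definition canonical_form :: "('v \<Rightarrow> complex) set \<Rightarrow> 'v \<Rightarrow> 'v \<Rightarrow> complex" where
  "canonical_form A x y = (\<Sum>\<alpha>\<in>A. \<alpha> x * \<alpha> y)"

definition nondegenerate :: "('v::zero \<Rightarrow> 'v \<Rightarrow> complex) \<Rightarrow> bool" where
  "nondegenerate G \<longleftrightarrow> (\<forall>x. (\<forall>y. G x y = 0) \<longrightarrow> x = 0)"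

text \<open>
  The vector \<open>\<alpha>\<^sup>\<or>\<close>. It exists and is unique when \<open>V\<close> is finite-dimensional, \<open>\<alpha>\<close> is linear
  and the canonical form of \<open>A\<close> is nondegenerate.
\<close>

definition vee :: "('v \<Rightarrow> complex) set \<Rightarrow> ('v \<Rightarrow> complex) \<Rightarrow> 'v" where
  "vee A \<alpha> = (THE v. \<forall>x. canonical_form A v x = \<alpha> x)"

definition vee_system ::
  "(complex \<Rightarrow> 'v::ab_group_add \<Rightarrow> 'v) \<Rightarrow> ('v \<Rightarrow> complex) set \<Rightarrow> bool" where
  "vee_system scale A \<longleftrightarrow>
     finite A \<and>
     A \<subseteq> dual_space scale \<and>
     pairwise (\<lambda>\<alpha> \<beta>. \<not> module.dependent fun_scale {\<alpha>, \<beta>}) A \<and>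
     module.span fun_scale A = dual_space scale \<and>
     nondegenerate (canonical_form A) \<and>
     (\<forall>\<alpha>\<in>A. \<forall>\<Pi>. \<Pi> \<subseteq> dual_space scale \<and> module.subspace fun_scale \<Pi> \<and>
                 vector_space.dim fun_scale \<Pi> = 2 \<and> \<alpha> \<in> \<Pi> \<longrightarrow>
        (\<exists>\<nu>. (\<Sum>\<beta>\<in>\<Pi> \<inter> A. scale (\<beta> (vee A \<alpha>)) (vee A \<beta>)) = scale \<nu> (vee A \<alpha>)))"

definition regular_points :: "('v \<Rightarrow> complex) set \<Rightarrow> 'v set" where
  "regular_points A = UNIV - (\<Union>\<alpha>\<in>A. {x. \<alpha> x = 0})"

text \<open>
  Polynomial functions are the algebra generated by the dual space. The predicate
  \<open>homogeneous_poly\<close> is its grading; the zero function is homogeneous of every degree.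
\<close>

inductive poly_function :: "(complex \<Rightarrow> 'v::ab_group_add \<Rightarrow> 'v) \<Rightarrow> ('v \<Rightarrow> complex) \<Rightarrow> bool"
  for scale where
  const: "poly_function scale (\<lambda>x. c)"
| linear: "f \<in> dual_space scale \<Longrightarrow> poly_function scale f"
| add: "poly_function scale f \<Longrightarrow> poly_function scale g \<Longrightarrow> poly_function scale (\<lambda>x. f x + g x)"
| mult: "poly_function scale f \<Longrightarrow> poly_function scale g \<Longrightarrow> poly_function scale (\<lambda>x. f x * g x)"

inductive homogeneous_poly ::
  "(complex \<Rightarrow> 'v::ab_group_add \<Rightarrow> 'v) \<Rightarrow> nat \<Rightarrow> ('v \<Rightarrow> complex) \<Rightarrow> bool"
  for scale where
  zero: "homogeneous_poly scale d (\<lambda>x. 0)"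
| const: "homogeneous_poly scale 0 (\<lambda>x. c)"
| linear: "f \<in> dual_space scale \<Longrightarrow> homogeneous_poly scale 1 f"
| add: "homogeneous_poly scale d f \<Longrightarrow> homogeneous_poly scale d g \<Longrightarrow>
        homogeneous_poly scale d (\<lambda>x. f x + g x)"
| mult: "homogeneous_poly scale d f \<Longrightarrow> homogeneous_poly scale e g \<Longrightarrow>
         homogeneous_poly scale (d + e) (\<lambda>x. f x * g x)"

text \<open>
  The components of a vector field \<open>\<psi>\<close> in all linear coordinate systems are the functions
  \<open>f \<circ> \<psi>\<close> with \<open>f\<close> in the dual space.
\<close>

definition poly_field :: "(complex \<Rightarrow> 'v::ab_group_add \<Rightarrow> 'v) \<Rightarrow> ('v \<Rightarrow> 'v) \<Rightarrow> bool" where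
  "poly_field scale \<psi> \<longleftrightarrow> (\<forall>f\<in>dual_space scale. poly_function scale (f \<circ> \<psi>))"

definition homogeneous_field ::
  "(complex \<Rightarrow> 'v::ab_group_add \<Rightarrow> 'v) \<Rightarrow> nat \<Rightarrow> ('v \<Rightarrow> 'v) \<Rightarrow> bool" where
  "homogeneous_field scale d \<psi> \<longleftrightarrow> (\<forall>f\<in>dual_space scale. homogeneous_poly scale d (f \<circ> \<psi>))"

text \<open>
  \<open>\<partial>\<^sub>\<xi> F(x) = D\<close> for a scalar function, and \<open>\<partial>\<^sub>\<xi> \<psi>(x) = v\<close> for a vector field. No topology
  is fixed on \<open>V\<close>, so the latter is taken componentwise.
\<close>

definition has_dir_deriv ::
  "(complex \<Rightarrow> 'v::ab_group_add \<Rightarrow> 'v) \<Rightarrow> ('v \<Rightarrow> complex) \<Rightarrow> 'v \<Rightarrow> 'v \<Rightarrow> complex \<Rightarrow> bool" where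
  "has_dir_deriv scale F \<xi> x D \<longleftrightarrow>
     ((\<lambda>t. F (x + scale t \<xi>)) has_field_derivative D) (at 0)"

definition has_field_dir_deriv ::
  "(complex \<Rightarrow> 'v::ab_group_add \<Rightarrow> 'v) \<Rightarrow> ('v \<Rightarrow> 'v) \<Rightarrow> 'v \<Rightarrow> 'v \<Rightarrow> 'v \<Rightarrow> bool" where
  "has_field_dir_deriv scale \<psi> \<xi> x v \<longleftrightarrow>
     (\<forall>f\<in>dual_space scale. has_dir_deriv scale (f \<circ> \<psi>) \<xi> x (f v))"

definition gradient_field ::
  "(complex \<Rightarrow> 'v::ab_group_add \<Rightarrow> 'v) \<Rightarrow> ('v \<Rightarrow> complex) set \<Rightarrow> ('v \<Rightarrow> 'v) \<Rightarrow> bool" where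
  "gradient_field scale A \<psi> \<longleftrightarrow>
     (\<exists>F. poly_function scale F \<and>
          (\<forall>x \<eta>. has_dir_deriv scale F \<eta> x (canonical_form A (\<psi> x) \<eta>)))"

definition logarithmic_field ::
  "(complex \<Rightarrow> 'v::ab_group_add \<Rightarrow> 'v) \<Rightarrow> ('v \<Rightarrow> complex) set \<Rightarrow> ('v \<Rightarrow> 'v) \<Rightarrow> bool" where
  "logarithmic_field scale A \<psi> \<longleftrightarrow>
     poly_field scale \<psi> \<and> (\<forall>\<alpha>\<in>A. \<forall>x. \<alpha> x = 0 \<longrightarrow> \<alpha> (\<psi> x) = 0)"

end

theory Submission
  imports Defs "HOL-Computational_Algebra.Polynomial"
begin

text \<open>
  For \<open>\<xi> = x\<close> the right-hand side of the equation is \<open>\<kappa> \<Sum> \<alpha>(\<psi>(x)) \<alpha>\<^sup>\<or> = \<kappa> \<psi>(x)\<close>, so Euler's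
  identity makes \<open>\<psi>\<close> homogeneous of degree \<open>\<kappa>\<close>. Pairing with \<open>\<eta>\<close> gives an expression
  symmetric in \<open>\<xi>\<close> and \<open>\<eta>\<close>, so \<open>F(x) = G(\<psi>(x), x) / (\<kappa> + 1)\<close> is a potential. Clearing
  denominators turns the equation into an identity of polynomials, which on \<open>\<alpha> = 0\<close> reduces to
  the vanishing of \<open>\<alpha>(\<psi>(x)) \<Prod>\<^bsub>\<beta> \<noteq> \<alpha>\<^esub> \<beta>(x)\<close>; as \<open>\<beta>\<close> is not identically zero on that hyperplane,
  \<open>\<alpha>(\<psi>)\<close> vanishes there.
\<close>

locale complex_vector_space = vector_space scale
  for scale :: "complex \<Rightarrow> 'v::ab_group_add \<Rightarrow> 'v"
begin

section \<open>Covectors\<close>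

lemma dual_add: "f \<in> dual_space scale \<Longrightarrow> f (x + y) = f x + f y"
  by (auto simp: dual_space_def Vector_Spaces.linear_iff)

lemma dual_scale: "f \<in> dual_space scale \<Longrightarrow> f (scale c x) = c * f x"
  by (auto simp: dual_space_def Vector_Spaces.linear_iff)

lemma dual_zero: "f \<in> dual_space scale \<Longrightarrow> f 0 = 0"
  using dual_scale[of f 0 0] by simp

lemma dual_diff: "f \<in> dual_space scale \<Longrightarrow> f (x - y) = f x - f y"
  using dual_add[of f "x - y" y] by simp

lemma dual_sum: "f \<in> dual_space scale \<Longrightarrow> f (\<Sum>i\<in>I. g i) = (\<Sum>i\<in>I. f (g i))"
  by (induction I rule: infinite_finite_induct) (auto simp: dual_add dual_zero)

lemma dual_spaceI:
  assumes "\<And>x y. f (x + y) = f x + f y" "\<And>c x. f (scale c x) = c * f x"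
  shows "f \<in> dual_space scale"
proof -
  have "vector_space ((*) :: complex \<Rightarrow> complex \<Rightarrow> complex)"
    by unfold_locales (auto simp: algebra_simps)
  then show ?thesis
    using assms vector_space_axioms by (auto simp: dual_space_def Vector_Spaces.linear_iff)
qed

lemma dual_on_lines:
  "f \<in> dual_space scale \<Longrightarrow> f (x + scale t u) = f x + t * f u"
  by (simp add: dual_add dual_scale)

section \<open>Polynomial functions: closure, restriction to lines, grading, derivatives\<close>

lemma poly_function_sum:
  "(\<And>i. i \<in> I \<Longrightarrow> poly_function scale (f i)) \<Longrightarrow> poly_function scale (\<lambda>x. \<Sum>i\<in>I. f i x)"
  by (induction I rule: infinite_finite_induct)
    (auto intro: poly_function.const[of _ 0] poly_function.add)

lemma poly_function_prod:
  "(\<And>i. i \<in> I \<Longrightarrow> poly_function scale (f i)) \<Longrightarrow> poly_function scale (\<lambda>x. \<Prod>i\<in>I. f i x)"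
  by (induction I rule: infinite_finite_induct)
    (auto intro: poly_function.const[of _ 1] poly_function.mult)

lemma poly_function_cmult: "poly_function scale f \<Longrightarrow> poly_function scale (\<lambda>x. c * f x)"
  using poly_function.mult[OF poly_function.const[of scale c]] by blast

lemma poly_function_diff:
  assumes "poly_function scale f" "poly_function scale g"
  shows "poly_function scale (\<lambda>x. f x - g x)"
  using poly_function.add[OF assms(1) poly_function_cmult[OF assms(2), of "-1"]] by simp

lemma homogeneous_poly_sum:
  "(\<And>i. i \<in> I \<Longrightarrow> homogeneous_poly scale d (f i)) \<Longrightarrow> homogeneous_poly scale d (\<lambda>x. \<Sum>i\<in>I. f i x)"
  by (induction I rule: infinite_finite_induct)
    (auto intro: homogeneous_poly.zero homogeneous_poly.add)

lemma homogeneous_poly_imp_poly_function: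
  "homogeneous_poly scale d f \<Longrightarrow> poly_function scale f"
  by (induction rule: homogeneous_poly.induct) (auto intro: poly_function.intros)

text \<open>On a line every covector is a polynomial of degree at most 1 in the parameter. Root
  counting in one variable can thus replace a topology on the space.\<close>

lemma poly_function_on_lines:
  assumes "poly_function scale f"
  obtains p where "\<And>t. f (x + scale t u) = poly p t"
proof -
  have "\<exists>p. \<forall>t. f (x + scale t u) = poly p t"
    using assms
  proof (induction rule: poly_function.induct)
    case (const c)
    show ?case by (rule exI[of _ "[:c:]"]) simp
  next
    case (linear f)
    then show ?case by (intro exI[of _ "[:f x, f u:]"]) (simp add: dual_on_lines)
  next
    case (add f g)
    then obtain p q where "\<forall>t. f (x + scale t u) = poly p t" "\<forall>t. g (x + scale t u) = poly q t"
      by blast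
    then show ?case by (intro exI[of _ "p + q"]) simp
  next
    case (mult f g)
    then obtain p q where "\<forall>t. f (x + scale t u) = poly p t" "\<forall>t. g (x + scale t u) = poly q t"
      by blast
    then show ?case by (intro exI[of _ "p * q"]) simp
  qed
  then show ?thesis using that by blast
qed

text \<open>The coefficients of \<open>t \<mapsto> f(t x)\<close> are the homogeneous components of \<open>f\<close> at \<open>x\<close>.\<close>

lemma homogeneous_components:
  assumes "poly_function scale f"
  obtains P where "\<And>x t. f (scale t x) = poly (P x) t"
    and "\<And>k. homogeneous_poly scale k (\<lambda>x. coeff (P x) k)"
proof -
  have "\<exists>P. (\<forall>x t. f (scale t x) = poly (P x) t) \<and>
            (\<forall>k. homogeneous_poly scale k (\<lambda>x. coeff (P x) k))"
    using assms
  proof (induction rule: poly_function.induct)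
    case (const c)
    have "homogeneous_poly scale k (\<lambda>x. coeff [:c:] k)" for k
      by (cases k) (auto intro: homogeneous_poly.intros)
    then show ?case by (intro exI[of _ "\<lambda>_. [:c:]"]) simp
  next
    case (linear f)
    have "homogeneous_poly scale k (\<lambda>x. coeff [:0, f x:] k)" for k
    proof (cases "k = 1")
      case True
      then show ?thesis using homogeneous_poly.linear[OF linear] by simp
    next
      case False
      then have "(\<lambda>x. coeff [:0, f x:] k) = (\<lambda>x. 0)"
        by (auto simp: coeff_pCons split: nat.splits)
      then show ?thesis by (simp add: homogeneous_poly.zero)
    qed
    then show ?case
      using linear by (intro exI[of _ "\<lambda>x. [:0, f x:]"]) (simp add: dual_scale)
  next
    case (add f g)
    then obtain P Q where
      "\<forall>x t. f (scale t x) = poly (P x) t" "\<forall>k. homogeneous_poly scale k (\<lambda>x. coeff (P x) k)"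
      "\<forall>x t. g (scale t x) = poly (Q x) t" "\<forall>k. homogeneous_poly scale k (\<lambda>x. coeff (Q x) k)"
      by blast
    then show ?case
      by (intro exI[of _ "\<lambda>x. P x + Q x"]) (simp add: homogeneous_poly.add)
  next
    case (mult f g)
    then obtain P Q where PQ:
      "\<forall>x t. f (scale t x) = poly (P x) t" "\<forall>k. homogeneous_poly scale k (\<lambda>x. coeff (P x) k)"
      "\<forall>x t. g (scale t x) = poly (Q x) t" "\<forall>k. homogeneous_poly scale k (\<lambda>x. coeff (Q x) k)"
      by blast
    have "homogeneous_poly scale k (\<lambda>x. coeff (P x * Q x) k)" for k
      unfolding coeff_mult
    proof (rule homogeneous_poly_sum)
      fix i assume "i \<in> {..k}"
      then show "homogeneous_poly scale k (\<lambda>x. coeff (P x) i * coeff (Q x) (k - i))"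
        using homogeneous_poly.mult[OF PQ(2)[rule_format, of i] PQ(4)[rule_format, of "k - i"]]
        by simp
    qed
    then show ?case
      using PQ by (intro exI[of _ "\<lambda>x. P x * Q x"]) simp
  qed
  then show ?thesis using that by blast
qed

text \<open>The derivative exists at every point, including the hyperplanes where the equation says
  nothing, and is again polynomial. Formulas for it at regular points can therefore be
  extended.\<close>

lemma poly_function_dir_deriv:
  assumes "poly_function scale f"
  obtains g where "poly_function scale g" "\<And>x. has_dir_deriv scale f \<xi> x (g x)"
proof -
  have "\<exists>g. poly_function scale g \<and> (\<forall>x. has_dir_deriv scale f \<xi> x (g x))"
    using assms
  proof (induction rule: poly_function.induct)
    case (const c)
    show ?case
      by (rule exI[of _ "\<lambda>_. 0"]) (auto simp: has_dir_deriv_def intro: poly_function.const)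
  next
    case (linear f)
    have "((\<lambda>t. f x + t * f \<xi>) has_field_derivative f \<xi>) (at 0)" for x
      by (auto intro!: derivative_eq_intros)
    then show ?case
      using linear by (intro exI[of _ "\<lambda>_. f \<xi>"])
        (auto simp: has_dir_deriv_def dual_on_lines intro: poly_function.const)
  next
    case (add f g)
    then obtain f' g' where
      "poly_function scale f'" "\<forall>x. has_dir_deriv scale f \<xi> x (f' x)"
      "poly_function scale g'" "\<forall>x. has_dir_deriv scale g \<xi> x (g' x)"
      by blast
    then show ?case
      by (intro exI[of _ "\<lambda>x. f' x + g' x"])
        (auto simp: has_dir_deriv_def intro: poly_function.add DERIV_add)
  next
    case (mult f g)
    then obtain f' g' where fg:
      "poly_function scale f'" "\<forall>x. has_dir_deriv scale f \<xi> x (f' x)"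
      "poly_function scale g'" "\<forall>x. has_dir_deriv scale g \<xi> x (g' x)"
      by blast
    have "has_dir_deriv scale (\<lambda>x. f x * g x) \<xi> x (f' x * g x + g' x * f x)" for x
      using DERIV_mult[OF fg(2)[rule_format, of x, unfolded has_dir_deriv_def]
          fg(4)[rule_format, of x, unfolded has_dir_deriv_def]]
      by (simp add: has_dir_deriv_def)
    then show ?case
      using mult fg
      by (intro exI[of _ "\<lambda>x. f' x * g x + g' x * f x"])
        (auto intro: poly_function.add poly_function.mult)
  qed
  then show ?thesis using that by blast
qed

section \<open>Vanishing of polynomials off finitely many hyperplanes\<close>

lemma finite_zeros_on_line:
  assumes "finite S" "S \<subseteq> dual_space scale" "\<And>f. f \<in> S \<Longrightarrow> f u \<noteq> 0"
  shows "finite {t. \<exists>f\<in>S. f (x + scale t u) = 0}"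
proof (rule finite_subset)
  show "{t. \<exists>f\<in>S. f (x + scale t u) = 0} \<subseteq> (\<lambda>f. - f x / f u) ` S"
  proof
    fix t assume "t \<in> {t. \<exists>f\<in>S. f (x + scale t u) = 0}"
    then obtain f where f: "f \<in> S" "f (x + scale t u) = 0" by blast
    then have "f x + t * f u = 0" using assms(2) by (auto simp: dual_on_lines subset_iff)
    then have "t = - f x / f u"
      using assms(3)[OF f(1)] by (simp add: field_simps add_eq_0_iff)
    then show "t \<in> (\<lambda>f. - f x / f u) ` S" using f(1) by blast
  qed
qed (use assms in simp)

text \<open>A complex vector space is not a finite union of proper subspaces. If the vector
  \<open>u\<close> found for \<open>S\<close> is killed by \<open>f\<close>, then \<open>f\<close>
  is constant and nonzero on the line \<open>w + t u\<close>, and each member of \<open>S\<close>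
  excludes only one \<open>t\<close>.\<close>

lemma common_nonzero:
  assumes "finite S" "S \<subseteq> dual_space scale" "subspace W"
    and "\<And>f. f \<in> S \<Longrightarrow> \<exists>w\<in>W. f w \<noteq> 0"
  shows "\<exists>u\<in>W. \<forall>f\<in>S. f u \<noteq> 0"
  using assms
proof (induction S rule: finite_induct)
  case empty
  then show ?case using subspace_0 by auto
next
  case (insert f S)
  then obtain u where u: "u \<in> W" "\<forall>g\<in>S. g u \<noteq> 0" by auto
  obtain w where w: "w \<in> W" "f w \<noteq> 0" using insert.prems by blast
  show ?case
  proof (cases "f u = 0")
    case False
    then show ?thesis using u by auto
  next
    case fu: True
    have f: "f \<in> dual_space scale" and S: "S \<subseteq> dual_space scale" using insert.prems by auto
    have "finite ({0} \<union> {t. \<exists>g\<in>S. g (w + scale t u) = 0})"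
      using finite_zeros_on_line[OF insert.hyps(1) S] u(2) by blast
    then obtain t where t: "t \<notin> {0} \<union> {t. \<exists>g\<in>S. g (w + scale t u) = 0}"
      using ex_new_if_finite infinite_UNIV_char_0 by blast
    have "w + scale t u \<in> W"
      using u w insert.prems(2) by (simp add: subspace_add subspace_scale)
    moreover have "f (w + scale t u) \<noteq> 0" using f fu w by (simp add: dual_on_lines)
    ultimately show ?thesis using t by blast
  qed
qed

text \<open>A line through \<open>x\<close> inside \<open>W\<close>, in a direction off all the
  hyperplanes, meets them finitely often. The restriction of \<open>f\<close> to it has infinitely
  many roots, hence is zero, also at \<open>t = 0\<close>. The cases needed are the whole space and
  the kernel of one covector.\<close>

lemma poly_function_eq_0_on_subspace:
  assumes f: "poly_function scale f"
    and S: "finite S" "S \<subseteq> dual_space scale" and W: "subspace W"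
    and nz: "\<And>g. g \<in> S \<Longrightarrow> \<exists>w\<in>W. g w \<noteq> 0"
    and zero: "\<And>x. x \<in> W \<Longrightarrow> (\<forall>g\<in>S. g x \<noteq> 0) \<Longrightarrow> f x = 0"
    and x: "x \<in> W"
  shows "f x = 0"
proof -
  obtain u where u: "u \<in> W" "\<forall>g\<in>S. g u \<noteq> 0" using common_nonzero[OF S W nz] by blast
  obtain p where p: "\<And>t. f (x + scale t u) = poly p t"
    using poly_function_on_lines[OF f] by blast
  have "- {t. \<exists>g\<in>S. g (x + scale t u) = 0} \<subseteq> {t. poly p t = 0}"
    using zero x u W by (auto simp: p[symmetric] subspace_add subspace_scale)
  moreover have "infinite (- {t. \<exists>g\<in>S. g (x + scale t u) = 0})"
    using finite_zeros_on_line[OF S] u(2)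
    by (simp add: Compl_eq_Diff_UNIV infinite_UNIV_char_0 Diff_infinite_finite)
  ultimately have "infinite {t. poly p t = 0}" using finite_subset by blast
  then have "p = 0" using poly_roots_finite by blast
  then show ?thesis using p[of 0] by simp
qed

section \<open>The canonical form, collinear covectors and representation of covectors\<close>

lemma canonical_form_sym: "canonical_form A x y = canonical_form A y x"
  by (simp add: canonical_form_def mult.commute)

lemma canonical_form_in_dual:
  "A \<subseteq> dual_space scale \<Longrightarrow> canonical_form A x \<in> dual_space scale"
  by (rule dual_spaceI)
    (auto simp: canonical_form_def dual_add dual_scale subset_iff sum.distrib sum_distrib_left
      algebra_simps intro!: sum.cong)

lemma canonical_form_dual_left:
  "A \<subseteq> dual_space scale \<Longrightarrow> (\<lambda>x. canonical_form A x y) \<in> dual_space scale"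
  using canonical_form_in_dual[of A y] by (simp add: canonical_form_sym[of A _ y])

lemma nondegenerate_eqI:
  assumes "A \<subseteq> dual_space scale" "nondegenerate (canonical_form A)"
    and "\<And>y. canonical_form A v y = canonical_form A w y"
  shows "v = w"
proof -
  have "canonical_form A (v - w) y = 0" for y
    using assms(3) by (simp add: dual_diff[OF canonical_form_dual_left[OF assms(1)]])
  then have "v - w = 0" using assms(2) unfolding nondegenerate_def by blast
  then show ?thesis by simp
qed

text \<open>Subtracting a multiple of \<open>w\<close> moves \<open>x\<close> into the kernel of
  \<open>\<alpha>\<close>, where \<open>\<beta>\<close> vanishes too.\<close>

lemma dual_eq_multiple:
  assumes "\<alpha> \<in> dual_space scale" "\<beta> \<in> dual_space scale" "\<alpha> w \<noteq> 0"
    and "\<And>x. \<alpha> x = 0 \<Longrightarrow> \<beta> x = 0"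
  shows "\<beta> = fun_scale (\<beta> w / \<alpha> w) \<alpha>"
proof
  fix x
  have "\<alpha> (x - scale (\<alpha> x / \<alpha> w) w) = 0" using assms(1-3) by (simp add: dual_diff dual_scale)
  then have "\<beta> (x - scale (\<alpha> x / \<alpha> w) w) = 0" by (rule assms(4))
  then show "\<beta> x = fun_scale (\<beta> w / \<alpha> w) \<alpha> x"
    using assms(1-3) by (simp add: dual_diff dual_scale fun_scale_def field_simps)
qed

end

text \<open>Distinctness keeps the set from collapsing to a singleton, which is dependent only for
  the zero covector.\<close>

lemma fun_scale_dependent:
  fixes \<alpha> \<beta> :: "'v \<Rightarrow> complex"
  assumes "\<beta> = fun_scale c \<alpha>" "\<alpha> \<noteq> \<beta>"
  shows "module.dependent fun_scale {\<alpha>, \<beta>}"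
proof -
  interpret F: vector_space "fun_scale :: complex \<Rightarrow> ('v \<Rightarrow> complex) \<Rightarrow> _"
    by (rule vector_space_fun_scale)
  have "\<beta> \<in> F.span {\<alpha>}" using assms(1) by (simp add: F.span_base F.span_scale)
  then show ?thesis
    unfolding F.dependent_def using assms(2)
    by (intro bexI[of _ \<beta>]) (auto simp: insert_Diff_if)
qed

text \<open>The map \<open>L\<close> sends \<open>v\<close> to the vector with coordinates
  \<open>G v b\<close>. Nondegeneracy makes it injective; being an endomorphism in finite dimension,
  it is then surjective and reaches the vector with coordinates \<open>f b\<close>.\<close>

lemma (in finite_dimensional_vector_space) nondegenerate_represents:
  fixes G :: "'b \<Rightarrow> 'b \<Rightarrow> 'a"
  assumes lin1: "\<And>y. Vector_Spaces.linear scale (*) (\<lambda>x. G x y)"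
    and lin2: "\<And>x. Vector_Spaces.linear scale (*) (G x)"
    and nondeg: "\<And>x. (\<And>y. G x y = 0) \<Longrightarrow> x = 0"
    and f: "Vector_Spaces.linear scale (*) f"
  shows "\<exists>v. \<forall>x. G v x = f x"
proof -
  have vs: "vector_space ((*) :: 'a \<Rightarrow> 'a \<Rightarrow> 'a)"
    by unfold_locales (auto simp: algebra_simps)
  have vp: "vector_space_pair scale ((*) :: 'a \<Rightarrow> 'a \<Rightarrow> 'a)"
    using vs vector_space_axioms by (simp add: vector_space_pair_def)
  define L where "L v = (\<Sum>b\<in>Basis. G v b *s b)" for v
  have eq_on_basis: "g = h"
    if "Vector_Spaces.linear scale (*) g" "Vector_Spaces.linear scale (*) h"
      "\<And>b. b \<in> Basis \<Longrightarrow> g b = h b" for g h :: "'b \<Rightarrow> 'a"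
    using vector_space_pair.linear_eq_on_span[OF vp that(1,2), of Basis] that(3) span_Basis
    by (auto simp: fun_eq_iff)
  have coeffs: "\<And>b. b \<in> Basis \<Longrightarrow> c b = d b"
    if "(\<Sum>b\<in>Basis. c b *s b) = (\<Sum>b\<in>Basis. d b *s b)" for c d
  proof -
    have "(\<Sum>b\<in>Basis. (c b - d b) *s b) = 0"
      using that by (simp add: scale_left_diff_distrib sum_subtractf)
    then show "\<And>b. b \<in> Basis \<Longrightarrow> c b = d b"
      using independentD[OF independent_Basis finite_Basis order_refl] by fastforce
  qed
  have linL: "Vector_Spaces.linear scale scale L"
    using lin1 vector_space_axioms unfolding L_def
    by (auto simp: Vector_Spaces.linear_iff scale_left_distrib sum.distrib scale_sum_right)
  have zero: "Vector_Spaces.linear scale (*) (\<lambda>_. 0 :: 'a)"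
    using vs vector_space_axioms by (simp add: Vector_Spaces.linear_iff)
  have "v = 0" if "L v = 0" for v
  proof -
    have "(\<Sum>b\<in>Basis. G v b *s b) = (\<Sum>b\<in>Basis. 0 *s b)" using that by (simp add: L_def)
    then have "G v = (\<lambda>_. 0)" by (intro eq_on_basis[OF lin2 zero] coeffs)
    then show ?thesis using nondeg by (simp add: fun_eq_iff)
  qed
  then have "inj L" using vector_space_pair.linear_inj_iff_eq_0[OF _ linL] vector_space_axioms
    by (simp add: vector_space_pair_def)
  then have "surj L" using linear_inj_imp_surj[OF linL] by blast
  then obtain v where "L v = (\<Sum>b\<in>Basis. f b *s b)" by (metis surjD)
  then have "G v = f" unfolding L_def by (intro eq_on_basis[OF lin2 f] coeffs)
  then show ?thesis by auto
qed

text \<open>\<open>0 \<in> A\<close> is possible only for \<open>V = 0\<close>, which \<open>A_nonzero\<close> excludes.\<close>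

locale covector_equation = complex_vector_space scale
  for scale :: "complex \<Rightarrow> 'v::ab_group_add \<Rightarrow> 'v" +
  fixes A :: "('v \<Rightarrow> complex) set" and \<kappa> :: complex and \<psi> :: "'v \<Rightarrow> 'v"
  assumes finite_A: "finite A"
    and A_dual: "A \<subseteq> dual_space scale"
    and A_nonzero: "\<alpha> \<in> A \<Longrightarrow> \<exists>w. \<alpha> w \<noteq> 0"
    and non_collinear: "pairwise (\<lambda>\<alpha> \<beta>. \<not> module.dependent fun_scale {\<alpha>, \<beta>}) A"
    and nondegenerate_A: "nondegenerate (canonical_form A)"
    and vee: "\<alpha> \<in> A \<Longrightarrow> canonical_form A (vee A \<alpha>) x = \<alpha> x"
    and poly_field: "poly_field scale \<psi>"
    and equation: "x \<in> regular_points A \<Longrightarrow>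
           has_field_dir_deriv scale \<psi> \<xi> x
             (scale \<kappa> (\<Sum>\<alpha>\<in>A. scale (\<alpha> \<xi> * \<alpha> (\<psi> x) / \<alpha> x) (vee A \<alpha>)))"
begin

section \<open>Separation by covectors, reconstruction of vectors, extension from regular
  points\<close>

lemma dualI: "\<alpha> \<in> A \<Longrightarrow> \<alpha> \<in> dual_space scale"
  using A_dual by blast

lemmas pairing_dual = canonical_form_dual_left[OF A_dual]

lemma eq_if_dual_eq:
  assumes "\<And>f. f \<in> dual_space scale \<Longrightarrow> f v = f w"
  shows "v = w"
  using assms[OF pairing_dual] by (rule nondegenerate_eqI[OF A_dual nondegenerate_A])

text \<open>Pairing the sum with \<open>y\<close> gives the defining sum of
  \<open>canonical_form A x y\<close>. This identity collapses the right-hand side of the equation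
  for \<open>\<xi> = x\<close>.\<close>

lemma sum_vee: "(\<Sum>\<alpha>\<in>A. scale (\<alpha> x) (vee A \<alpha>)) = x"
proof (rule nondegenerate_eqI[OF A_dual nondegenerate_A])
  show "canonical_form A (\<Sum>\<alpha>\<in>A. scale (\<alpha> x) (vee A \<alpha>)) y = canonical_form A x y" for y
    by (simp only: dual_sum[OF pairing_dual] dual_scale[OF pairing_dual])
      (simp add: vee canonical_form_def[of A x y])
qed

lemma poly_function_eq_0:
  assumes "poly_function scale f" "\<And>x. x \<in> regular_points A \<Longrightarrow> f x = 0"
  shows "f x = 0"
  by (rule poly_function_eq_0_on_subspace[OF assms(1) finite_A A_dual subspace_UNIV])
    (use A_nonzero assms(2) in \<open>auto simp: regular_points_def\<close>)

lemma poly_function_comp: "f \<in> dual_space scale \<Longrightarrow> poly_function scale (f \<circ> \<psi>)"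
  using poly_field by (simp add: poly_field_def)

lemma poly_function_comp_app: "f \<in> dual_space scale \<Longrightarrow> poly_function scale (\<lambda>x. f (\<psi> x))"
  using poly_function_comp by (simp add: comp_def)

section \<open>Euler's identity and homogeneity\<close>

lemma deriv_self:
  assumes "x \<in> regular_points A"
  shows "has_field_dir_deriv scale \<psi> x x (scale \<kappa> (\<psi> x))"
proof -
  have "(\<Sum>\<alpha>\<in>A. scale (\<alpha> x * \<alpha> (\<psi> x) / \<alpha> x) (vee A \<alpha>)) = (\<Sum>\<alpha>\<in>A. scale (\<alpha> (\<psi> x)) (vee A \<alpha>))"
    using assms by (intro sum.cong) (auto simp: regular_points_def)
  then show ?thesis using equation[OF assms, of x] by (simp add: sum_vee)
qed

lemma regular_scale:
  "x \<in> regular_points A \<Longrightarrow> s \<noteq> 0 \<Longrightarrow> scale s x \<in> regular_points A"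
  using dualI by (auto simp: regular_points_def dual_scale)

text \<open>On the ray through a regular \<open>x\<close>, Euler's identity reads
  \<open>s p'(s) = \<kappa> p(s)\<close>, so the coefficients satisfy
  \<open>(k - \<kappa>) p_k = 0\<close>. At most the one of degree \<open>\<kappa>\<close> survives,
  and none if \<open>\<kappa>\<close> is not a natural number.\<close>

lemma dual_comp_homogeneous:
  assumes f: "f \<in> dual_space scale"
  shows "\<kappa> = of_nat d \<Longrightarrow> homogeneous_poly scale d (f \<circ> \<psi>)"
    and "\<nexists>d::nat. \<kappa> = of_nat d \<Longrightarrow> f (\<psi> x) = 0"
proof -
  obtain P where P: "\<And>x t. (f \<circ> \<psi>) (scale t x) = poly (P x) t"
    and hom: "\<And>k. homogeneous_poly scale k (\<lambda>x. coeff (P x) k)"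
    using homogeneous_components[OF poly_function_comp[OF f]] by blast
  \<comment> \<open>Differentiate at \<open>s x\<close> in the direction \<open>s x\<close>, so that
    the parameter on the ray is \<open>s + t s\<close>. The restriction \<open>s \<noteq> 0\<close>
    keeps \<open>s x\<close> regular.\<close>
  have euler: "s * poly (pderiv (P x)) s = \<kappa> * poly (P x) s"
    if x: "x \<in> regular_points A" and s: "s \<noteq> 0" for x s
  proof -
    have "has_dir_deriv scale (f \<circ> \<psi>) (scale s x) (scale s x) (\<kappa> * f (\<psi> (scale s x)))"
      using deriv_self[OF regular_scale[OF x s]] f
      by (auto simp: has_field_dir_deriv_def dual_scale)
    moreover have "scale s x + scale t (scale s x) = scale (s + t * s) x" for t
      by (simp add: scale_left_distrib)
    moreover have "f (\<psi> (scale s x)) = poly (P x) s" using P[of s x] by simp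
    ultimately have
      "((\<lambda>t. poly (P x) (s + t * s)) has_field_derivative \<kappa> * poly (P x) s) (at 0)"
      by (simp only: has_dir_deriv_def P)
    moreover have
      "((\<lambda>t. poly (P x) (s + t * s)) has_field_derivative poly (pderiv (P x)) s * s) (at 0)"
      by (rule DERIV_chain2[of "poly (P x)"]) (auto intro!: derivative_eq_intros poly_DERIV)
    ultimately show ?thesis by (metis DERIV_unique mult.commute)
  qed
  have coeffs: "coeff (P x) k = 0" if x: "x \<in> regular_points A" and k: "of_nat k \<noteq> \<kappa>" for x k
  proof -
    \<comment> \<open>\<open>pCons 0\<close> multiplies by the variable, so \<open>?q\<close> is
      \<open>s p' - \<kappa> p\<close>, with coefficients \<open>(k - \<kappa>) p_k\<close>.\<close>
    let ?q = "pCons 0 (pderiv (P x)) - smult \<kappa> (P x)"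
    have "UNIV - {0} \<subseteq> {s. poly ?q s = 0}" using euler[OF x] by auto
    moreover have "infinite (UNIV - {0::complex})"
      by (simp add: infinite_UNIV_char_0)
    ultimately have "?q = 0" using poly_roots_finite finite_subset by blast
    then have "coeff ?q k = 0" by simp
    then have "(of_nat k - \<kappa>) * coeff (P x) k = 0"
      by (cases k) (auto simp: coeff_pderiv algebra_simps)
    then show ?thesis using k by simp
  qed
  have at_1: "f (\<psi> x) = poly (P x) 1" for x using P[of 1 x] by simp
  show "homogeneous_poly scale d (f \<circ> \<psi>)" if d: "\<kappa> = of_nat d"
  proof -
    have "P x = monom (coeff (P x) d) d" if "x \<in> regular_points A" for x
      using coeffs[OF that] d by (intro poly_eqI) auto
    then have "f (\<psi> x) = poly (monom (coeff (P x) d) d) 1" if "x \<in> regular_points A" for x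
      using at_1[of x] that by simp
    then have "f (\<psi> x) = coeff (P x) d" if "x \<in> regular_points A" for x
      using that by (simp add: poly_monom)
    \<comment> \<open>The homogeneous component is itself polynomial in \<open>x\<close>, so the
      equality extends from the regular points to all points.\<close>
    moreover have "poly_function scale (\<lambda>x. f (\<psi> x) - coeff (P x) d)"
      by (intro poly_function_diff poly_function_comp_app[OF f]
          homogeneous_poly_imp_poly_function[OF hom])
    ultimately have "f (\<psi> x) - coeff (P x) d = 0" for x
      using poly_function_eq_0[of "\<lambda>x. f (\<psi> x) - coeff (P x) d"] by simp
    then have "f \<circ> \<psi> = (\<lambda>x. coeff (P x) d)" by auto
    then show ?thesis using hom[of d] by simp
  qed
  show "f (\<psi> x) = 0" if nonnat: "\<nexists>d::nat. \<kappa> = of_nat d"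
  proof -
    have "P x = 0" if "x \<in> regular_points A" for x
      using coeffs[OF that] nonnat by (intro poly_eqI) (metis coeff_0)
    then show "f (\<psi> x) = 0"
      using poly_function_eq_0[OF poly_function_comp_app[OF f]] at_1 by auto
  qed
qed

text \<open>For any other \<open>\<kappa>\<close> every covector would vanish at
  \<open>\<psi> x\<close>, but covectors separate points.\<close>

lemma homogeneous:
  assumes "\<psi> x \<noteq> 0"
  shows "\<exists>d::nat. \<kappa> = of_nat d \<and> homogeneous_field scale d \<psi>"
proof -
  have "\<exists>d::nat. \<kappa> = of_nat d"
  proof (rule ccontr)
    assume "\<nexists>d::nat. \<kappa> = of_nat d"
    then have "f (\<psi> x) = f 0" if "f \<in> dual_space scale" for f
      using dual_comp_homogeneous(2)[OF that] that by (simp add: dual_zero)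
    then show False using assms eq_if_dual_eq by blast
  qed
  then obtain d :: nat where d: "\<kappa> = of_nat d" by blast
  then have "homogeneous_poly scale d (f \<circ> \<psi>)" if "f \<in> dual_space scale" for f
    using dual_comp_homogeneous(1)[OF that] by blast
  then show ?thesis using d by (auto simp: homogeneous_field_def)
qed

section \<open>The potential\<close>

lemma deriv_pairing:
  assumes "x \<in> regular_points A"
  shows "has_dir_deriv scale (\<lambda>x. canonical_form A (\<psi> x) \<eta>) \<xi> x
           (\<kappa> * (\<Sum>\<alpha>\<in>A. \<alpha> \<xi> * \<alpha> \<eta> * \<alpha> (\<psi> x) / \<alpha> x))"
proof -
  let ?f = "\<lambda>x. canonical_form A x \<eta>"
  have "has_dir_deriv scale (?f \<circ> \<psi>) \<xi> x
      (?f (scale \<kappa> (\<Sum>\<alpha>\<in>A. scale (\<alpha> \<xi> * \<alpha> (\<psi> x) / \<alpha> x) (vee A \<alpha>))))"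
    using equation[OF assms, of \<xi>] pairing_dual[of \<eta>]
    unfolding has_field_dir_deriv_def by blast
  also have "?f (scale \<kappa> (\<Sum>\<alpha>\<in>A. scale (\<alpha> \<xi> * \<alpha> (\<psi> x) / \<alpha> x) (vee A \<alpha>))) =
      \<kappa> * (\<Sum>\<alpha>\<in>A. \<alpha> \<xi> * \<alpha> \<eta> * \<alpha> (\<psi> x) / \<alpha> x)"
    by (simp only: dual_sum[OF pairing_dual] dual_scale[OF pairing_dual])
      (simp add: vee algebra_simps)
  finally show ?thesis by (simp add: comp_def)
qed

text \<open>Product rule: moving the argument of \<open>\<psi>\<close> contributes
  \<open>\<kappa>\<close> times the pairing with \<open>\<eta>\<close>, moving the second slot
  contributes it once more.\<close>

lemma canonical_form_self_dir_deriv: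
  assumes "x \<in> regular_points A"
  shows "has_dir_deriv scale (\<lambda>x. canonical_form A (\<psi> x) x) \<eta> x
           ((\<kappa> + 1) * canonical_form A (\<psi> x) \<eta>)"
proof -
  let ?D = "\<kappa> * (\<Sum>\<alpha>\<in>A. \<alpha> \<eta> * \<alpha> x * \<alpha> (\<psi> x) / \<alpha> x)"
  have D: "?D = \<kappa> * canonical_form A (\<psi> x) \<eta>"
    using assms unfolding canonical_form_def
    by (intro arg_cong[of _ _ "(*) \<kappa>"] sum.cong) (auto simp: regular_points_def)
  \<comment> \<open>The second slot is frozen at \<open>x\<close>; with \<open>x\<close> as the
    pairing vector, the factor \<open>\<alpha> x\<close> cancels the denominators.\<close>
  have 1: "((\<lambda>t. canonical_form A (\<psi> (x + scale t \<eta>)) x) has_field_derivative ?D) (at 0)"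
    using deriv_pairing[OF assms, of x \<eta>] by (simp only: has_dir_deriv_def)
  \<comment> \<open>Only the existence of this derivative matters: at \<open>t = 0\<close> the
    product rule multiplies it by 0.\<close>
  obtain g where g: "\<And>x. has_dir_deriv scale (\<lambda>x. canonical_form A (\<psi> x) \<eta>) \<eta> x (g x)"
    using poly_function_dir_deriv[OF poly_function_comp_app[OF pairing_dual]] by blast
  have 2: "((\<lambda>t. t * canonical_form A (\<psi> (x + scale t \<eta>)) \<eta>) has_field_derivative
      canonical_form A (\<psi> x) \<eta>) (at 0)"
    using DERIV_mult[OF DERIV_ident g[of x, unfolded has_dir_deriv_def]] by simp
  have "canonical_form A (\<psi> (x + scale t \<eta>)) (x + scale t \<eta>) =
      canonical_form A (\<psi> (x + scale t \<eta>)) x + t * canonical_form A (\<psi> (x + scale t \<eta>)) \<eta>" for t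
    by (rule dual_on_lines[OF canonical_form_in_dual[OF A_dual]])
  then show ?thesis
    using DERIV_add[OF 1 2] unfolding has_dir_deriv_def D by (simp add: algebra_simps)
qed

lemma gradient:
  assumes "\<kappa> + 1 \<noteq> 0"
  shows "gradient_field scale A \<psi>"
proof -
  let ?H = "\<lambda>x. canonical_form A (\<psi> x) x"
  have H: "poly_function scale ?H"
    unfolding canonical_form_def
    by (intro poly_function_sum poly_function.mult poly_function_comp_app)
      (auto intro: poly_function.linear dualI)
  have "has_dir_deriv scale (\<lambda>x. 1 / (\<kappa> + 1) * ?H x) \<eta> x (canonical_form A (\<psi> x) \<eta>)" for x \<eta>
  proof -
    obtain g where g: "poly_function scale g" "\<And>x. has_dir_deriv scale ?H \<eta> x (g x)"
      using poly_function_dir_deriv[OF H] by blast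
    \<comment> \<open>Both sides are polynomial in \<open>x\<close>, so comparing them at regular
      points suffices.\<close>
    have "g x - (\<kappa> + 1) * canonical_form A (\<psi> x) \<eta> = 0" if "x \<in> regular_points A" for x
      using DERIV_unique[OF g(2)[of x, unfolded has_dir_deriv_def]
          canonical_form_self_dir_deriv[OF that, of \<eta>, unfolded has_dir_deriv_def]]
      by simp
    moreover have "poly_function scale (\<lambda>x. g x - (\<kappa> + 1) * canonical_form A (\<psi> x) \<eta>)"
      by (intro poly_function_diff g(1) poly_function_cmult poly_function_comp_app[OF pairing_dual])
    ultimately have "g x - (\<kappa> + 1) * canonical_form A (\<psi> x) \<eta> = 0"
      using poly_function_eq_0[of "\<lambda>x. g x - (\<kappa> + 1) * canonical_form A (\<psi> x) \<eta>"] by blast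
    then have "canonical_form A (\<psi> x) \<eta> = 1 / (\<kappa> + 1) * g x"
      using assms by simp
    then show ?thesis
      using DERIV_cmult[OF g(2)[of x, unfolded has_dir_deriv_def], of "1 / (\<kappa> + 1)"]
      unfolding has_dir_deriv_def by simp
  qed
  then show ?thesis
    using poly_function_cmult[OF H, of "1 / (\<kappa> + 1)"] unfolding gradient_field_def by blast
qed

section \<open>Tangency to the hyperplanes\<close>

text \<open>Otherwise \<open>\<beta>\<close> would be a multiple of \<open>\<alpha>\<close>. Hence
  the other hyperplanes cut the kernel of \<open>\<alpha>\<close> in proper subspaces, and the
  vanishing principle applies on it.\<close>

lemma ex_kernel_nonzero:
  assumes "\<alpha> \<in> A" "\<beta> \<in> A - {\<alpha>}"
  shows "\<exists>w. \<alpha> w = 0 \<and> \<beta> w \<noteq> 0"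
proof (rule ccontr)
  assume *: "\<nexists>w. \<alpha> w = 0 \<and> \<beta> w \<noteq> 0"
  obtain w where "\<alpha> w \<noteq> 0" using A_nonzero[OF assms(1)] by blast
  then have "\<beta> = fun_scale (\<beta> w / \<alpha> w) \<alpha>"
    using * assms by (intro dual_eq_multiple dualI) auto
  then have "module.dependent fun_scale {\<alpha>, \<beta>}"
    using fun_scale_dependent assms by blast
  then show False using non_collinear assms by (auto simp: pairwise_def)
qed

lemma tangent:
  assumes "\<kappa> \<noteq> 0" and \<alpha>: "\<alpha> \<in> A" and x: "\<alpha> x = 0"
  shows "\<alpha> (\<psi> x) = 0"
proof -
  \<comment> \<open>A single direction \<open>y\<close> serves both for differentiation and for
    pairing. The term of \<open>\<alpha>\<close> then carries the nonzero factor
    \<open>\<alpha> y * \<alpha> y\<close>.\<close>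
  obtain y where y: "\<alpha> y \<noteq> 0" using A_nonzero[OF \<alpha>] by blast
  obtain g where g: "poly_function scale g"
    "\<And>x. has_dir_deriv scale (\<lambda>x. canonical_form A (\<psi> x) y) y x (g x)"
    using poly_function_dir_deriv[OF poly_function_comp_app[OF pairing_dual]] by blast
  let ?L = "\<lambda>z. g z * (\<Prod>\<beta>\<in>A. \<beta> z)"
  let ?R = "\<lambda>z. \<kappa> * (\<Sum>\<beta>\<in>A. (\<beta> y * \<beta> y) * (\<beta> (\<psi> z) * (\<Prod>\<gamma>\<in>A - {\<beta>}. \<gamma> z)))"
  have "?L z - ?R z = 0" if z: "z \<in> regular_points A" for z
  proof -
    have "g z = \<kappa> * (\<Sum>\<beta>\<in>A. \<beta> y * \<beta> y * \<beta> (\<psi> z) / \<beta> z)"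
      using DERIV_unique[OF g(2)[of z, unfolded has_dir_deriv_def]
          deriv_pairing[OF z, of y y, unfolded has_dir_deriv_def]] .
    moreover have "\<beta> y * \<beta> y * \<beta> (\<psi> z) / \<beta> z * (\<Prod>\<gamma>\<in>A. \<gamma> z) =
        (\<beta> y * \<beta> y) * (\<beta> (\<psi> z) * (\<Prod>\<gamma>\<in>A - {\<beta>}. \<gamma> z))" if "\<beta> \<in> A" for \<beta>
      using z that prod.remove[OF finite_A that, of "\<lambda>\<gamma>. \<gamma> z"]
      by (auto simp: regular_points_def)
    ultimately show ?thesis by (simp add: sum_distrib_right mult.assoc)
  qed
  moreover have "poly_function scale (\<lambda>z. ?L z - ?R z)"
    by (intro poly_function_diff poly_function.mult[OF g(1)] poly_function_cmult poly_function_sum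
        poly_function.mult[OF poly_function_comp_app] poly_function_prod)
      (auto intro: poly_function.linear dualI)
  ultimately have LR: "?L z - ?R z = 0" for z
    using poly_function_eq_0[of "\<lambda>z. ?L z - ?R z"] by blast
  have prod_0: "\<alpha> (\<psi> z) * (\<Prod>\<gamma>\<in>A - {\<alpha>}. \<gamma> z) = 0" if z: "\<alpha> z = 0" for z
  proof -
    have L: "(\<Prod>\<beta>\<in>A. \<beta> z) = 0" using z \<alpha> finite_A by auto
    \<comment> \<open>For \<open>\<beta> \<noteq> \<alpha>\<close> the product over
      \<open>A - {\<beta>}\<close> still contains the factor \<open>\<alpha> z = 0\<close>.\<close>
    have "(\<Sum>\<beta>\<in>A - {\<alpha>}. (\<beta> y * \<beta> y) * (\<beta> (\<psi> z) * (\<Prod>\<gamma>\<in>A - {\<beta>}. \<gamma> z))) = 0"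
      using z \<alpha> finite_A by (intro sum.neutral) auto
    then have "?R z = \<kappa> * ((\<alpha> y * \<alpha> y) * (\<alpha> (\<psi> z) * (\<Prod>\<gamma>\<in>A - {\<alpha>}. \<gamma> z)))"
      using sum.remove[OF finite_A \<alpha>, of "\<lambda>\<beta>. (\<beta> y * \<beta> y) * (\<beta> (\<psi> z) * (\<Prod>\<gamma>\<in>A - {\<beta>}. \<gamma> z))"]
      by simp
    then show ?thesis using LR[of z, unfolded L] y assms(1) by auto
  qed
  show ?thesis
  proof (rule poly_function_eq_0_on_subspace[of "\<lambda>x. \<alpha> (\<psi> x)" "A - {\<alpha>}" "{z. \<alpha> z = 0}"])
    show "subspace {z. \<alpha> z = 0}"
      using dualI[OF \<alpha>] by (auto simp: subspace_def dual_zero dual_add dual_scale)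
    show "\<alpha> (\<psi> z) = 0" if "z \<in> {z. \<alpha> z = 0}" "\<forall>\<gamma>\<in>A - {\<alpha>}. \<gamma> z \<noteq> 0" for z
      using prod_0[of z] that finite_A by simp
  qed (use finite_A A_dual \<alpha> x ex_kernel_nonzero dualI poly_function_comp_app in auto)
qed

end

section \<open>From \<or>-systems to the locale assumptions\<close>

text \<open>Existence uses finite dimension, uniqueness nondegeneracy; together they make the
  definite description in \<open>vee\<close> meaningful.\<close>

lemma vee_represents:
  fixes scale :: "complex \<Rightarrow> 'v::ab_group_add \<Rightarrow> 'v"
  assumes "finite_dimensional_vector_space scale basis"
    and A: "A \<subseteq> dual_space scale" and nondeg: "nondegenerate (canonical_form A)"
    and \<alpha>: "\<alpha> \<in> dual_space scale"
  shows "canonical_form A (vee A \<alpha>) x = \<alpha> x"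
proof -
  interpret finite_dimensional_vector_space scale basis by fact
  interpret complex_vector_space scale by unfold_locales
  have "\<exists>v. \<forall>x. canonical_form A v x = \<alpha> x"
    using canonical_form_in_dual[OF A] canonical_form_dual_left[OF A] \<alpha> nondeg
    by (intro nondegenerate_represents) (auto simp: dual_space_def nondegenerate_def)
  moreover have "v = w"
    if "\<forall>x. canonical_form A v x = \<alpha> x" "\<forall>x. canonical_form A w x = \<alpha> x" for v w
    using that by (intro nondegenerate_eqI[OF A nondeg, of v w]) simp
  ultimately have "\<exists>!v. \<forall>x. canonical_form A v x = \<alpha> x" by blast
  from theI'[OF this] show ?thesis unfolding vee_def by blast
qed

text \<open>A zero covector is collinear with every other one, so it would be the only element of
  \<open>A\<close>, and the canonical form would vanish on a nonzero space.\<close>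

lemma nonzero_covector:
  fixes A :: "('v::ab_group_add \<Rightarrow> complex) set" and v :: 'v
  assumes nondeg: "nondegenerate (canonical_form A)"
    and non_collinear: "pairwise (\<lambda>\<alpha> \<beta>. \<not> module.dependent fun_scale {\<alpha>, \<beta>}) A"
    and v: "v \<noteq> 0" and \<alpha>: "\<alpha> \<in> A"
  shows "\<exists>w. \<alpha> w \<noteq> 0"
proof (rule ccontr)
  assume *: "\<nexists>w. \<alpha> w \<noteq> 0"
  have "\<beta> = \<alpha>" if "\<beta> \<in> A" for \<beta>
  proof (rule ccontr)
    assume "\<beta> \<noteq> \<alpha>"
    moreover have "\<alpha> = fun_scale 0 \<beta>" using * by (auto simp: fun_scale_def)
    ultimately show False
      using fun_scale_dependent[of \<alpha> 0 \<beta>] non_collinear that \<alpha> by (auto simp: pairwise_def)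
  qed
  then have "canonical_form A v y = 0" for y
    using * unfolding canonical_form_def by (intro sum.neutral) auto
  then show False using nondeg v by (auto simp: nondegenerate_def)
qed

text \<open>The two implications set aside degenerate cases. For \<open>\<kappa> = 0\<close> every
  constant field solves the equation, and a nonzero one is not tangent: some \<open>\<alpha>\<close>
  is nonzero on its value, yet vanishes at the origin. The zero field solves the equation for every
  \<open>\<kappa>\<close> and does not determine a degree.\<close>

theorem theorem3:
  fixes scale :: "complex \<Rightarrow> 'v::ab_group_add \<Rightarrow> 'v"
    and basis :: "'v set"
    and A :: "('v \<Rightarrow> complex) set"
    and \<kappa> :: complex
    and \<psi> :: "'v \<Rightarrow> 'v"
  assumes "finite_dimensional_vector_space scale basis"
    and "vee_system scale A"
    and "poly_field scale \<psi>"
    and "\<And>\<xi> x. x \<in> regular_points A \<Longrightarrow>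
           has_field_dir_deriv scale \<psi> \<xi> x
             (scale \<kappa> (\<Sum>\<alpha>\<in>A. scale (\<alpha> \<xi> * \<alpha> (\<psi> x) / \<alpha> x) (vee A \<alpha>)))"
  shows "gradient_field scale A \<psi> \<and>
         (\<kappa> \<noteq> 0 \<longrightarrow> logarithmic_field scale A \<psi>) \<and>
         ((\<exists>x. \<psi> x \<noteq> 0) \<longrightarrow> (\<exists>d::nat. \<kappa> = of_nat d \<and> homogeneous_field scale d \<psi>))"
proof -
  interpret finite_dimensional_vector_space scale basis by fact
  interpret complex_vector_space scale by unfold_locales
  have A: "finite A" "A \<subseteq> dual_space scale" "nondegenerate (canonical_form A)"
    "pairwise (\<lambda>\<alpha> \<beta>. \<not> module.dependent fun_scale {\<alpha>, \<beta>}) A"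
    using assms(2) by (simp_all add: vee_system_def)
  show ?thesis
  proof (cases "\<exists>x. \<psi> x \<noteq> 0")
    case False
    then have 0: "\<alpha> (\<psi> x) = 0" if "\<alpha> \<in> A" for \<alpha> x
      using that A(2) by (auto simp: dual_zero)
    then have "canonical_form A (\<psi> x) \<eta> = 0" for x \<eta>
      unfolding canonical_form_def by (intro sum.neutral) simp
    then have "gradient_field scale A \<psi>"
      unfolding gradient_field_def has_dir_deriv_def
      by (intro exI[of _ "\<lambda>_. 0"]) (simp add: poly_function.const)
    then show ?thesis using False 0 assms(3) by (simp add: logarithmic_field_def)
  next
    case True
    then obtain x where x: "\<psi> x \<noteq> 0" by blast
    \<comment> \<open>The nonzero value \<open>\<psi> x\<close> supplies the nonzero vector that
      keeps the zero covector out of \<open>A\<close>.\<close>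
    interpret covector_equation scale A \<kappa> \<psi>
      using A assms(3,4) nonzero_covector[OF A(3,4) x]
        vee_represents[OF assms(1) A(2,3)]
      by unfold_locales auto
    obtain d :: nat where d: "\<kappa> = of_nat d" "homogeneous_field scale d \<psi>"
      using homogeneous[OF x] by blast
    \<comment> \<open>As a positive natural number, \<open>\<kappa> + 1\<close> can be divided by in
      the potential.\<close>
    then have "\<kappa> + 1 = of_nat (Suc d)" by simp
    then have "\<kappa> + 1 \<noteq> 0" by (simp only: of_nat_eq_0_iff)
    then show ?thesis
      using gradient tangent d assms(3) by (auto simp: logarithmic_field_def)
  qed
qed

end
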